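(* Let $\mathbf{F}_q$ be a finite field with $q$ elements, $f\in MF_n^n(\mathbf{F}_q)$ a coupled monomial dynamical system and $F$ its corresponding matrix, an $n\times n$ matrix with entries in $E_q=\{0,\dots,q-1\}$. If $F$, viewed as a real matrix, has the characteristic polynomial $$a(\lambda-1)^s\lambda^t$$ where $a\in\mathbb{Z}\setminus\{0\}$ and $s,t\in\mathbb{N}_0$ satisfy $s+t=n$, and the geometric multiplicity of the eigenvalues $0$ and $1$ is equal to the corresponding algebraic multiplicity, then $f$ is a fixed point system.
   Context: Convention: $x^0=1$ for all $x\in\mathbf{F}_q$. A monomial dynamical system $f\in MF_n^n(\mathbf{F}_q)$ ($n$ a positive integer) is a map $f:\mathbf{F}_q^n\to\mathbf{F}_q^n$ for which there is a (necessarily unique) $n\times n$ matrix $F$ with entries in $E_q$, called the corresponding matrix of $f$, such that $f_i(x)=x_1^{F_{i1}}\cdots x_n^{F_{in}}$ for all $x\in\mathbf{F}_q^n$ and all $i$. $f$ is a fixed point system if every trajectory $x,f(x),f^2(x),\dots$ ends in a fixed point of $f$; equivalently there is $m\ge1$ with $f^{m+\lambda}=f^m$ for all $\lambda\ge1$. The dependency graph of $f$ is the directed multigraph with vertices $a_1,\dots,a_n$ and exactly $F_{ij}$ directed edges from $a_i$ to $a_j$ for all $i,j$. A strongly connected component (in the usual sense) is trivial if it consists of a single vertex $a$ and there is no edge $a\to a$. $f$ is coupled if its dependency graph contains nontrivial strongly connected components. *)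

theory Defs
  imports
    "HOL-Library.Cardinality"
    "Jordan_Normal_Form.Char_Poly"
    "Jordan_Normal_Form.Matrix_Kernel"
    "Graph_Theory.Digraph_Component"
begin

text \<open>
  The finite field is a type \<open>'a :: {field, finite}\<close> with \<open>q = CARD('a)\<close> elements, and
  \<open>F\<^sub>q\<^sup>n\<close> is \<open>carrier_vec n\<close>, with coordinates numbered from \<open>0\<close>. The values of a map
  outside \<open>carrier_vec n\<close> are irrelevant for all notions below. The convention
  \<open>x ^ 0 = 1\<close>, also for \<open>x = 0\<close>, is that of the library.
\<close>

definition represents :: "nat \<Rightarrow> ('a :: {field, finite} vec \<Rightarrow> 'a vec) \<Rightarrow> nat mat \<Rightarrow> bool" where
  "represents n f F \<longleftrightarrow>
     F \<in> carrier_mat n n \<and>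
     (\<forall>i<n. \<forall>j<n. F $$ (i, j) \<in> {0..CARD('a) - 1}) \<and>
     (\<forall>x\<in>carrier_vec n. f x = vec n (\<lambda>i. \<Prod>j<n. (x $ j) ^ (F $$ (i, j))))"

definition monomial_systems :: "nat \<Rightarrow> ('a :: {field, finite} vec \<Rightarrow> 'a vec) set" where
  "monomial_systems n = {f. \<exists>F. represents n f F}"

lemma power_eq_imp_exponent_eq:
  fixes a b :: nat
  assumes a: "a \<le> CARD('a :: {field, finite}) - 1" and b: "b \<le> CARD('a) - 1"
    and eq: "\<And>y :: 'a. y ^ a = y ^ b"
  shows "a = b"
proof (rule ccontr)
  assume ne: "a \<noteq> b"
  define p where "p = monom (1 :: 'a) a - monom 1 b"
  have "coeff p a = 1" using ne by (simp add: p_def)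
  hence p0: "p \<noteq> 0" by auto
  have "degree p \<le> CARD('a) - 1"
    unfolding p_def using a b by (intro degree_diff_le) (simp_all add: degree_monom_eq)
  moreover have "poly p y = 0" for y
    using eq[of y] by (simp add: p_def poly_monom)
  hence "{y. poly p y = 0} = UNIV" by auto
  hence "CARD('a) \<le> degree p" using card_poly_roots_bound[OF p0] by simp
  moreover have "CARD('a) > 0" by (simp add: card_gt_0_iff)
  ultimately show False by linarith
qed

lemma represents_unique:
  fixes f :: "'a :: {field, finite} vec \<Rightarrow> 'a vec"
  assumes F: "represents n f F" and G: "represents n f G"
  shows "F = G"
proof (rule eq_matI)
  show "dim_row F = dim_row G" "dim_col F = dim_col G"
    using F G by (auto simp: represents_def)
next
  fix i j assume "i < dim_row G" "j < dim_col G"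
  hence i: "i < n" and j: "j < n" using G by (auto simp: represents_def)
  have *: "(\<Prod>k<n. (vec n (\<lambda>k. if k = j then y else 1) $ k) ^ (H $$ (i, k))) = y ^ (H $$ (i, j))"
    for y :: 'a and H :: "nat mat"
  proof -
    have "(\<Prod>k<n. (vec n (\<lambda>k. if k = j then y else 1) $ k) ^ (H $$ (i, k)))
        = (\<Prod>k<n. if k = j then y ^ (H $$ (i, j)) else 1)"
      by (intro prod.cong) auto
    thus ?thesis using j by simp
  qed
  have "y ^ (F $$ (i, j)) = y ^ (G $$ (i, j))" for y :: 'a
  proof -
    let ?x = "vec n (\<lambda>k. if k = j then y else 1)"
    have x: "?x \<in> carrier_vec n" by simp
    have "f ?x $ i = y ^ (F $$ (i, j))"
      using F i x unfolding represents_def *[of y F, symmetric] by simp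
    moreover have "f ?x $ i = y ^ (G $$ (i, j))"
      using G i x unfolding represents_def *[of y G, symmetric] by simp
    ultimately show ?thesis by simp
  qed
  thus "F $$ (i, j) = G $$ (i, j)"
    using F G i j by (intro power_eq_imp_exponent_eq[where 'a = 'a]) (auto simp: represents_def)
qed

definition corresponding_matrix :: "nat \<Rightarrow> ('a :: {field, finite} vec \<Rightarrow> 'a vec) \<Rightarrow> nat mat" where
  "corresponding_matrix n f = (THE F. represents n f F)"

lemma represents_corresponding_matrix:
  assumes "f \<in> monomial_systems n"
  shows "represents n f (corresponding_matrix n f)"
proof -
  have "\<exists>!F. represents n f F"
    using assms represents_unique unfolding monomial_systems_def by blast
  thus ?thesis unfolding corresponding_matrix_def by (rule theI')
qed

definition fixed_point_system :: "nat \<Rightarrow> ('a vec \<Rightarrow> 'a vec) \<Rightarrow> bool" where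
  "fixed_point_system n f \<longleftrightarrow> (\<forall>x\<in>carrier_vec n. \<exists>m. f ((f ^^ m) x) = (f ^^ m) x)"

text \<open>The triple \<open>(i, j, k)\<close> is the \<open>k\<close>-th of the parallel arcs from \<open>i\<close> to \<open>j\<close>.\<close>

definition dependency_graph ::
    "nat \<Rightarrow> ('a :: {field, finite} vec \<Rightarrow> 'a vec) \<Rightarrow> (nat, nat \<times> nat \<times> nat) pre_digraph" where
  "dependency_graph n f =
     \<lparr> verts = {..<n},
       arcs = {(i, j, k). i < n \<and> j < n \<and> k < corresponding_matrix n f $$ (i, j)},
       tail = (\<lambda>(i, j, k). i),
       head = (\<lambda>(i, j, k). j) \<rparr>"

definition trivial_scc :: "('v, 'e) pre_digraph \<Rightarrow> bool" where
  "trivial_scc H \<longleftrightarrow> (\<exists>a. verts H = {a} \<and> \<not> (\<exists>e\<in>arcs H. tail H e = a \<and> head H e = a))"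

definition coupled :: "nat \<Rightarrow> ('a :: {field, finite} vec \<Rightarrow> 'a vec) \<Rightarrow> bool" where
  "coupled n f \<longleftrightarrow> (\<exists>H\<in>pre_digraph.sccs (dependency_graph n f). \<not> trivial_scc H)"

definition geometric_multiplicity :: "'b :: field mat \<Rightarrow> 'b \<Rightarrow> nat" where
  "geometric_multiplicity A e = kernel_dim (char_matrix A e)"

definition algebraic_multiplicity :: "'b :: field mat \<Rightarrow> 'b \<Rightarrow> nat" where
  "algebraic_multiplicity A e = Polynomial.order e (char_poly A)"

end

theory Submission
  imports
    Defs
    "Jordan_Normal_Form.Jordan_Normal_Form_Existence"
    "Jordan_Normal_Form.Jordan_Normal_Form_Uniqueness"
begin

text \<open>
  Since \<open>0\<close> and \<open>1\<close> are the only eigenvalues of \<open>F\<close> and their geometric and algebraic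
  multiplicities agree, all Jordan blocks have size one, so \<open>F\<close> is similar to a diagonal matrix
  with entries in \<open>{0, 1}\<close> and hence \<open>F * F = F\<close>. Composing monomial maps multiplies their
  exponent matrices, so \<open>f \<circ> f = f\<close>: every point reaches a fixed point after one step.
\<close>

text \<open>A single strict inequality would make the second sum strictly larger. Serves to compare
  the number of Jordan blocks with the sum of their sizes.\<close>

lemma sum_list_eq_imp_eq:
  fixes g h :: "'b \<Rightarrow> nat"
  assumes "sum_list (map g xs) = sum_list (map h xs)"
    and "\<And>x. x \<in> set xs \<Longrightarrow> g x \<le> h x"
    and "x \<in> set xs"
  shows "g x = h x"
  using assms
proof (induction xs)
  case (Cons y ys)
  have "sum_list (map g ys) \<le> sum_list (map h ys)"
    using Cons.prems by (intro sum_list_mono) auto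
  moreover have "g y \<le> h y" using Cons.prems by simp
  ultimately have "g y = h y" "sum_list (map g ys) = sum_list (map h ys)"
    using Cons.prems(1) by simp_all
  with Cons show ?case by auto
qed simp

text \<open>The geometric multiplicity counts the Jordan blocks for \<open>e\<close>, while the
  algebraic one adds up their sizes; as every size is at least 1, equality leaves only size
  1.\<close>

lemma jordan_block_size_eq_1:
  assumes jnf: "jordan_nf A n_as"
    and mult: "geometric_multiplicity A e = algebraic_multiplicity A e"
    and mem: "(k, e) \<in> set n_as"
  shows "k = 1"
proof -
  let ?ks = "map fst (filter (\<lambda>na. snd na = e) n_as)"
  have "similar_mat A (jordan_matrix n_as)" using jnf by (simp add: jordan_nf_def)
  from similar_matD[OF this] obtain m where A: "A \<in> carrier_mat m m" by blast
  \<comment> \<open>Needed at the end: \<open>min 1 k = k\<close> gives only k \<le> 1, and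
    \<open>jordan_nf\<close> rules out empty blocks.\<close>
  have pos: "x \<ge> 1" if "x \<in> set ?ks" for x
    using jnf that unfolding jordan_nf_def by (force simp: Suc_le_eq)
  \<comment> \<open>Presents the eigenspace as the generalized eigenspace of order 1, in whose
    dimension a block of size \<open>x\<close> counts \<open>min 1 x\<close>.\<close>
  have "char_matrix A e ^\<^sub>m 1 = char_matrix A e"
    using A by (simp add: char_matrix_def left_mult_one_mat[of _ m m])
  hence "geometric_multiplicity A e = (\<Sum>x\<leftarrow>?ks. min 1 x)"
    using dim_gen_eigenspace[OF jnf, of e 1]
    by (simp add: geometric_multiplicity_def dim_gen_eigenspace_def case_prod_unfold)
  moreover have "algebraic_multiplicity A e = (\<Sum>x\<leftarrow>?ks. x)"
    unfolding algebraic_multiplicity_def jordan_nf_order[OF jnf]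
    by (simp add: case_prod_unfold)
  moreover have "k \<in> set ?ks" using mem by force
  ultimately have "min 1 k = k"
    using mult by (intro sum_list_eq_imp_eq[of "min 1" ?ks "\<lambda>x. x"]) auto
  with pos[OF \<open>k \<in> set ?ks\<close>] show ?thesis by simp
qed

lemma idempotent_if_diagonalizable_01:
  fixes A :: "'b :: conjugatable_ordered_field mat"
  assumes A: "A \<in> carrier_mat n n"
    and cp: "char_poly A = [:-1, 1:] ^ s * [:0, 1:] ^ t"
    and mult0: "geometric_multiplicity A 0 = algebraic_multiplicity A 0"
    and mult1: "geometric_multiplicity A 1 = algebraic_multiplicity A 1"
  shows "A * A = A"
proof -
  \<comment> \<open>The Jordan normal form exists because the characteristic polynomial splits into
    linear factors.\<close>
  have "char_poly A = (\<Prod>e\<leftarrow>replicate s 1 @ replicate t 0. [:-e, 1:])"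
    unfolding cp by simp
  then obtain n_as where jnf: "jordan_nf A n_as"
    using jordan_nf_exists[OF A] by blast
  have block: "jordan_block k e ^\<^sub>m 2 = jordan_block k e" if mem: "(k, e) \<in> set n_as" for k e
  proof -
    have "k \<noteq> 0" using jnf mem unfolding jordan_nf_def by force
    \<comment> \<open>The size of a block bounds the order of its eigenvalue from below, so
      \<open>e\<close> is a root of the characteristic polynomial.\<close>
    hence "Polynomial.order e (char_poly A) \<noteq> 0"
      using jordan_nf_block_size_order_bound[OF jnf mem] by simp
    hence "poly (char_poly A) e = 0" by (metis order_0I)
    hence e: "e = 0 \<or> e = 1" unfolding cp by (auto simp: poly_power split: if_splits)
    hence "k = 1" using jordan_block_size_eq_1[OF jnf _ mem] mult0 mult1 by blast
    \<comment> \<open>A block of size 1 is the scalar \<open>e\<close>, and both 0 and 1 are their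
      own squares.\<close>
    with e show ?thesis
      by (intro eq_matI) (auto simp: numeral_2_eq_2 scalar_prod_def)
  qed
  let ?J = "jordan_matrix n_as"
  have J: "?J ^\<^sub>m 2 = ?J"
    unfolding jordan_matrix_pow
    using block by (auto simp: jordan_matrix_def intro!: arg_cong[of _ _ diag_block_mat])
  obtain P Q where wit: "similar_mat_wit A ?J P Q"
    using jnf unfolding jordan_nf_def similar_mat_def by blast
  have "A ^\<^sub>m 2 = A"
    using similar_mat_wit_pow_id[OF wit, of 2] similar_mat_witD2(3)[OF A wit] J by simp
  thus ?thesis using A by (simp add: numeral_2_eq_2)
qed

text \<open>Substituting monomials into a monomial adds up the exponents of each variable, which is
  the matrix product. The entries of \<open>F * G\<close> may exceed q - 1, hence an explicit
  formula instead of \<open>represents\<close>.\<close>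

lemma represents_compose:
  assumes f: "represents n f F" and g: "represents n g G" and x: "x \<in> carrier_vec n"
  shows "f (g x) = vec n (\<lambda>i. \<Prod>k<n. (x $ k) ^ ((F * G) $$ (i, k)))"
proof (rule eq_vecI)
  have gx: "g x \<in> carrier_vec n" using g x by (simp add: represents_def)
  have FG: "F \<in> carrier_mat n n" "G \<in> carrier_mat n n"
    using f g by (simp_all add: represents_def)
  show "dim_vec (f (g x)) = dim_vec (vec n (\<lambda>i. \<Prod>k<n. (x $ k) ^ ((F * G) $$ (i, k))))"
    using f gx by (simp add: represents_def)
  fix i assume "i < dim_vec (vec n (\<lambda>i. \<Prod>k<n. (x $ k) ^ ((F * G) $$ (i, k))))"
  hence i: "i < n" by simp
  have "f (g x) $ i = (\<Prod>j<n. (\<Prod>k<n. (x $ k) ^ (G $$ (j, k))) ^ (F $$ (i, j)))"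
    using f g x gx i by (simp add: represents_def)
  also have "\<dots> = (\<Prod>k<n. \<Prod>j<n. (x $ k) ^ (G $$ (j, k) * F $$ (i, j)))"
    unfolding prod_power_distrib power_mult by (rule prod.swap)
  also have "\<dots> = (\<Prod>k<n. (x $ k) ^ (\<Sum>j<n. F $$ (i, j) * G $$ (j, k)))"
    by (simp add: power_sum mult.commute)
  also have "\<dots> = (\<Prod>k<n. (x $ k) ^ ((F * G) $$ (i, k)))"
    using FG i by (intro prod.cong) (auto simp: scalar_prod_def atLeast0LessThan)
  finally show "f (g x) $ i = vec n (\<lambda>i. \<Prod>k<n. (x $ k) ^ ((F * G) $$ (i, k))) $ i"
    using i by simp
qed

theorem theorem55:
  fixes n s t :: nat and a :: int
    and f :: "'a :: {field, finite} vec \<Rightarrow> 'a vec" and F :: "nat mat"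
  assumes "n \<ge> 1"
    and "f \<in> monomial_systems n"
    and "coupled n f"
    and "F = corresponding_matrix n f"
    and "a \<noteq> 0"
    and "s + t = n"
    and "char_poly (map_mat real F) = Polynomial.smult (of_int a) ([:-1, 1:] ^ s * [:0, 1:] ^ t)"
    and "geometric_multiplicity (map_mat real F) 0 = algebraic_multiplicity (map_mat real F) 0"
    and "geometric_multiplicity (map_mat real F) 1 = algebraic_multiplicity (map_mat real F) 1"
  shows "fixed_point_system n f"
proof -
  let ?R = "map_mat real F"
  interpret real_hom: inj_semiring_hom real
    by unfold_locales auto
  have rep: "represents n f F"
    using represents_corresponding_matrix assms(2,4) by blast
  hence F: "F \<in> carrier_mat n n" by (simp add: represents_def)
  hence R: "?R \<in> carrier_mat n n" by simp
  \<comment> \<open>Comparing leading coefficients of monic polynomials forces \<open>a\<close> to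
    be 1.\<close>
  have "lead_coeff (char_poly ?R) = 1" using degree_monic_char_poly[OF R] by simp
  moreover have "lead_coeff ([:-1, 1:] ^ s * [:0, 1:] ^ t :: real poly) = 1"
    by (simp add: lead_coeff_mult lead_coeff_power)
  ultimately have "real_of_int a = 1"
    using assms(5) unfolding assms(7) by simp
  hence "char_poly ?R = [:-1, 1:] ^ s * [:0, 1:] ^ t" using assms(7) by simp
  hence "?R * ?R = ?R"
    using idempotent_if_diagonalizable_01[OF R] assms(8,9) by blast
  hence "map_mat real (F * F) = map_mat real F"
    by (simp add: real_hom.mat_hom_mult[OF F F])
  \<comment> \<open>The embedding of the naturals into the reals is injective, so idempotence holds
    for the exponents themselves and not merely modulo q - 1.\<close>
  hence "F * F = F" by (rule real_hom.mat_hom_inj)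
  hence "f (f x) = f x" if "x \<in> carrier_vec n" for x
    using represents_compose[OF rep rep that] rep that by (simp add: represents_def)
  thus ?thesis
    unfolding fixed_point_system_def by (auto intro!: exI[of _ 1])
qed

end
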